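(* Let $p=13\text{-}2$ (generalized pattern). For integers $k,\ell\ge 1$ put $m=\max(k,\ell)$. Then: (i) $\displaystyle G_{p}^{12\ldots k,\,12\ldots \ell}(x) = x^{k+\ell-1}C^{\ell+1}(x)+\frac{x^m-x^{k+\ell-1}}{1-x}$. (ii) $\displaystyle G_{p}^{12\ldots k,\,\ell(\ell-1)\ldots 1}(x) = x^{k+\ell-1}C^2(x)$. (iii) $\displaystyle G_{p}^{k(k-1)\ldots 1,\,\ell(\ell-1)\ldots 1}(x) = x^{k+\ell-1}C^{k+1}(x)+\frac{x^m-x^{k+\ell-1}}{1-x}$. (iv) The generating function $\displaystyle G_p(x,y,z)=\sum_{k,\ell\geq0}G_{p}^{k(k-1)\ldots1,\,12\ldots\ell}(x)\,y^kz^{\ell}$ equals $$\frac{1}{1-x(y+z)}\left( x(y+z+yz) +\frac{C(x)-1}{(1-xyC(x))(1-xzC(x))}\right).$$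
   Context: A permutation $\pi=\pi_1\cdots\pi_n$ of $\{1,\dots,n\}$ avoids the generalized pattern $13\text{-}2$ if there are no indices $a,b$ with $a+1<b\le n$ and $\pi_a<\pi_b<\pi_{a+1}$ (absence of a dash means the two corresponding letters must be adjacent in $\pi$). It begins with the pattern $12\ldots k$ (respectively $k(k-1)\ldots1$) if $n\ge k$ and $\pi_1<\cdots<\pi_k$ (respectively $\pi_1>\cdots>\pi_k$); it ends with the pattern $12\ldots\ell$ (respectively $\ell(\ell-1)\ldots 1$) if $n\ge\ell$ and $\pi_{n-\ell+1}<\cdots<\pi_n$ (respectively $\pi_{n-\ell+1}>\cdots>\pi_n$). The initial and final segments are allowed to overlap. $G_p^{q,r}(x)=\sum_{n\ge1}N_p^{q,r}(n)x^n$, where $N_p^{q,r}(n)$ is the number of permutations of $\{1,\dots,n\}$ that avoid $p$, begin with $q$ and end with $r$ (the empty permutation is not counted). For $k=0$ (respectively $\ell=0$) no condition is imposed on the beginning (respectively the end) of the permutation. $C(x)=\sum_{n\ge0}C_nx^n=\frac{1-\sqrt{1-4x}}{2x}$ is the generating function of the Catalan numbers, and $C^j(x)=(C(x))^j$. *)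

theory Defs
  imports
    Complex_Main
    "HOL-Computational_Algebra.Formal_Power_Series"
    "HOL-Combinatorics.Multiset_Permutations"
begin

unbundle fps_syntax

text \<open>
  A permutation of \<open>{1..n}\<close> is its word: a list in \<^term>\<open>permutations_of_set {1..n}\<close>,
  whose letters are indexed from 0.
\<close>

definition avoids_13_2 :: "nat list \<Rightarrow> bool" where
  "avoids_13_2 w \<longleftrightarrow>
     \<not> (\<exists>a b. a + 1 < b \<and> b < length w \<and> w ! a < w ! b \<and> w ! b < w ! (a + 1))"

definition begins_incr :: "nat \<Rightarrow> nat list \<Rightarrow> bool" where
  "begins_incr k w \<longleftrightarrow> k \<le> length w \<and> sorted_wrt (<) (take k w)"

definition begins_decr :: "nat \<Rightarrow> nat list \<Rightarrow> bool" where
  "begins_decr k w \<longleftrightarrow> k \<le> length w \<and> sorted_wrt (>) (take k w)"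

definition ends_incr :: "nat \<Rightarrow> nat list \<Rightarrow> bool" where
  "ends_incr l w \<longleftrightarrow> l \<le> length w \<and> sorted_wrt (<) (drop (length w - l) w)"

definition ends_decr :: "nat \<Rightarrow> nat list \<Rightarrow> bool" where
  "ends_decr l w \<longleftrightarrow> l \<le> length w \<and> sorted_wrt (>) (drop (length w - l) w)"

definition perm_count ::
    "(nat list \<Rightarrow> bool) \<Rightarrow> (nat list \<Rightarrow> bool) \<Rightarrow> (nat list \<Rightarrow> bool) \<Rightarrow> nat \<Rightarrow> nat" where
  "perm_count p q r n = card {w \<in> permutations_of_set {1..n}. p w \<and> q w \<and> r w}"

text \<open>The sum defining the series starts at \<open>n = 1\<close>.\<close>

definition perm_gf ::
    "(nat list \<Rightarrow> bool) \<Rightarrow> (nat list \<Rightarrow> bool) \<Rightarrow> (nat list \<Rightarrow> bool) \<Rightarrow> real fps" where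
  "perm_gf p q r = Abs_fps (\<lambda>n. if n = 0 then 0 else of_nat (perm_count p q r n))"

definition catalan_gf :: "real fps" where
  "catalan_gf = Abs_fps (\<lambda>n. of_nat (2 * n choose n) / of_nat (n + 1))"

lemma central_binomial_Suc:
  "(n + 1) * (2 * Suc n choose Suc n) = 2 * (2 * n + 1) * (2 * n choose n)"
proof -
  have a: "(n + 1) * (2 * Suc n choose Suc n) = (2 * n + 2) * (2 * n + 1 choose n)"
    using Suc_times_binomial[of n "2 * n + 1"] by simp
  have sym: "(2 * n + 1 choose n) = (2 * n + 1 choose Suc n)"
    using binomial_symmetric[of n "2 * n + 1"] by simp
  have b: "(n + 1) * (2 * n + 1 choose Suc n) = (2 * n + 1) * (2 * n choose n)"
    using Suc_times_binomial[of n "2 * n"] by simp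
  have "(n + 1) * (2 * Suc n choose Suc n) = 2 * ((n + 1) * (2 * n + 1 choose Suc n))"
    using a sym by (simp add: algebra_simps)
  with b show ?thesis
    by (simp only: mult.assoc)
qed

lemma gbinomial_half_catalan:
  "((1/2 :: real) gchoose Suc n) * (-4) ^ Suc n = -2 * catalan_gf $ n"
proof (induction n)
  case 0
  show ?case by (simp add: catalan_gf_def)
next
  case (Suc n)
  have c: "real (n + 2) * catalan_gf $ Suc n = 2 * (2 * real n + 1) * catalan_gf $ n"
  proof -
    define p where "p = real (2 * n choose n)"
    define q where "q = real (2 * Suc n choose Suc n)"
    have "real ((n + 1) * (2 * Suc n choose Suc n)) = real (2 * (2 * n + 1) * (2 * n choose n))"
      by (simp only: central_binomial_Suc)
    then have pq: "(real n + 1) * q = 2 * (2 * real n + 1) * p"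
      by (simp only: p_def q_def of_nat_mult of_nat_add of_nat_1 of_nat_numeral)
    have pos: "real n + 1 \<noteq> 0" "real n + 2 \<noteq> 0"
      by linarith+
    have "catalan_gf $ n = p / (real n + 1)" "catalan_gf $ Suc n = q / (real n + 2)"
      by (simp_all only: p_def q_def catalan_gf_def fps_nth_Abs_fps of_nat_add of_nat_1
          of_nat_Suc) (simp_all add: add.commute)
    then have p: "(real n + 1) * catalan_gf $ n = p"
      and q: "(real n + 2) * catalan_gf $ Suc n = q"
      using pos by simp_all
    have "(real n + 1) * q = (real n + 1) * (2 * (2 * real n + 1) * catalan_gf $ n)"
      unfolding pq p[symmetric] by (simp only: mult_ac)
    then have "q = 2 * (2 * real n + 1) * catalan_gf $ n"
      using pos(1) by (simp only: mult_cancel_left) simp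
    with q show ?thesis
      by (simp only: of_nat_add of_nat_numeral)
  qed
  have g: "real (n + 2) * ((1/2 :: real) gchoose Suc (Suc n))
      = (1/2 - real (n + 1)) * ((1/2) gchoose Suc n)"
    using gbinomial_mult_1[of "1/2 :: real" "Suc n"] by (simp add: algebra_simps)
  have "real (n + 2) * (((1/2 :: real) gchoose Suc (Suc n)) * (-4) ^ Suc (Suc n))
      = (real (n + 2) * ((1/2 :: real) gchoose Suc (Suc n))) * (-4) * (-4) ^ Suc n"
    by simp
  also have "\<dots> = (4 * real n + 2) * (((1/2) gchoose Suc n) * (-4) ^ Suc n)"
    unfolding g by (simp add: algebra_simps)
  also have "\<dots> = real (n + 2) * (-2 * catalan_gf $ Suc n)"
    unfolding Suc.IH using c by (simp add: algebra_simps)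
  finally show ?case
    by (simp only: mult_cancel_left of_nat_eq_0_iff) simp
qed

lemma catalan_gf_closed_form:
  "catalan_gf = (1 - fps_radical root 2 (1 - 4 * fps_X)) / (2 * fps_X)"
proof -
  define S :: "real fps" where "S = fps_binomial (1/2) oo (fps_const (-4) * fps_X)"
  have S_nth: "S $ n = (-4) ^ n * ((1/2) gchoose n)" for n
    by (simp add: S_def fps_compose_linear)
  have "S ^ 2 = (fps_binomial (1/2) ^ 2) oo (fps_const (-4) * fps_X)"
    by (simp add: S_def fps_compose_power)
  also have "\<dots> = (1 + fps_X) oo (fps_const (-4) * fps_X)"
    by (simp add: fps_binomial_power fps_binomial_1)
  also have "\<dots> = 1 - 4 * fps_X"
    by (simp add: fps_compose_add_distrib numeral_fps_const flip: fps_const_neg)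
  finally have sq: "S ^ Suc 1 = 1 - 4 * fps_X"
    by (simp add: numeral_2_eq_2)
  have "S = fps_radical root (Suc 1) (1 - 4 * fps_X)"
    using radical_unique[of root 1 "1 - 4 * fps_X :: real fps" S] sq by (simp add: S_nth)
  then have S: "fps_radical root 2 (1 - 4 * fps_X) = S"
    by (simp add: numeral_2_eq_2)
  have "1 - S = catalan_gf * (2 * fps_X)"
  proof (rule fps_ext)
    fix n
    have r: "catalan_gf * (2 * fps_X) = fps_const 2 * (catalan_gf * fps_X)"
      by (simp add: numeral_fps_const mult_ac)
    show "(1 - S) $ n = (catalan_gf * (2 * fps_X)) $ n"
    proof (cases n)
      case 0
      then show ?thesis by (simp add: r S_nth)
    next
      case (Suc j)
      have "S $ Suc j = -2 * catalan_gf $ j"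
        unfolding S_nth gbinomial_half_catalan[symmetric] by (rule mult.commute)
      with Suc show ?thesis
        unfolding r by simp
    qed
  qed
  then show ?thesis
    unfolding S by simp
qed

text \<open>
  Power series in \<open>x, y, z\<close> are iterated: \<^typ>\<open>real fps fps fps\<close>, with \<open>z\<close> the outermost
  and \<open>x\<close> the innermost variable.
\<close>

type_synonym fps_xyz = "real fps fps fps"

definition of_fps_x :: "real fps \<Rightarrow> fps_xyz" where
  "of_fps_x F = fps_const (fps_const F)"

definition X_var :: fps_xyz where "X_var = of_fps_x fps_X"

definition Y_var :: fps_xyz where "Y_var = fps_const fps_X"

definition Z_var :: fps_xyz where "Z_var = fps_X"

definition double_gf :: "(nat \<Rightarrow> nat \<Rightarrow> real fps) \<Rightarrow> fps_xyz" where
  "double_gf F = Abs_fps (\<lambda>l. Abs_fps (\<lambda>k. F k l))"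

text \<open>
  The library's division of series is meant for coefficients in a field; over an iterated
  series ring it is still division by units. The next lemmas check this for the three
  denominators that occur.
\<close>

lemma fps_divide_unit_iterated:
  fixes f g h :: fps_xyz
  assumes "g $ 0 $ 0 $ 0 \<noteq> 0"
  shows "f / g = h \<longleftrightarrow> f = h * g"
proof -
  have 1: "(g $ 0 $ 0) * inverse (g $ 0 $ 0) = 1"
    using assms by (simp add: inverse_mult_eq_1')
  have 2: "(g $ 0) * inverse (g $ 0) = 1"
    using fps_right_inverse[OF 1] by (simp add: fps_inverse_def)
  have 3: "g * inverse g = 1"
    using fps_right_inverse[OF 2] by (simp add: fps_inverse_def)
  have "g $ 0 \<noteq> 0"
    using assms by auto
  then have "f / g = f * inverse g"
    by (rule fps_divide_unit)
  moreover have "f * inverse g * g = f" "h * g * inverse g = h"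
    using 3 by (simp_all only: mult.assoc mult.commute[of "inverse g" g] mult_1_right)
  ultimately show ?thesis
    by metis
qed

lemma denominator_units:
  "(1 - X_var * (Y_var + Z_var)) $ 0 $ 0 $ 0 \<noteq> 0"
  "((1 - X_var * Y_var * of_fps_x C) * (1 - X_var * Z_var * of_fps_x C)) $ 0 $ 0 $ 0 \<noteq> 0"
  by (simp_all add: X_var_def Y_var_def Z_var_def of_fps_x_def)

end

theory Submission
  imports Defs
begin

text \<open>
  Cut an avoiding permutation at its largest letter \<open>m\<close>, say \<open>u m v\<close>. A letter of \<open>u\<close>
  smaller than a letter \<open>y\<close> of \<open>v\<close> would be followed, at some adjacent ascent of \<open>u m\<close>, by a
  jump over \<open>y\<close>; so every letter of \<open>u\<close> exceeds every letter of \<open>v\<close>, and conversely any two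
  avoiding words can be combined in this way (\<open>avoids_split_max\<close>). Iterating the cut
  identifies the avoiding permutations of \<open>{1..n}\<close> with the binary trees with \<open>n\<close> nodes
  (\<open>word_bij\<close>).

  The four kinds of boundary runs obey simple recursions along the root of the tree, because
  the largest letter stops a decreasing run that comes from the left and an increasing run
  that goes on to the right. An increasing run at the beginning lives in the left subtree,
  unless that subtree is a left comb (an increasing word), in which case the root prolongs
  the run by one; an increasing run at the end lives in the right subtree, unless that
  subtree is empty. Reflecting trees exchanges the beginning with the end and increasing with
  decreasing, which turns the decreasing--decreasing count into the increasing--increasing one.

  A root with independent conditions on its two subtrees has generating function
  \<open>x P(x) Q(x)\<close> (\<open>tree_gf_Node_of\<close>). So each recursion becomes a linear equation whose
  coefficients involve the series \<open>C\<close> of all trees, and \<open>C = 1 + x C\<^sup>2\<close>, that is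
  \<open>1 / (1 - x C) = C\<close>, solves it. In the increasing--increasing case, the block from \<open>x^m\<close>
  to \<open>x^(k+l-2)\<close> counts the permutations whose two prescribed segments share at least two
  letters; such a permutation is the identity. In the mixed case, peeling off a root with
  exactly one empty subtree shortens exactly one of the two runs, whence the factor
  \<open>1 - x (y + z)\<close>.
\<close>

section \<open>The Catalan equation\<close>

lemma catalan_gf_eq: "catalan_gf = 1 + fps_X * catalan_gf ^ 2"
proof -
  define S :: "real fps" where "S = fps_radical root 2 (1 - 4 * fps_X)"
  have S2: "S ^ 2 = 1 - 4 * fps_X"
    using power_radical[of "1 - 4 * fps_X :: real fps" root 1]
    by (simp add: S_def numeral_2_eq_2)
  have "1 - S = fps_const (1/2) * fps_shift 1 (1 - S) * (2 * fps_X)"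
    by (rule fps_ext) (auto simp: S_def fps_numeral_fps_const mult_ac)
  then have "2 * fps_X dvd 1 - S"
    by (metis dvd_triv_right)
  then have "1 - S = catalan_gf * (2 * fps_X)"
    by (simp add: catalan_gf_closed_form S_def)
  then have "S = 1 - 2 * fps_X * catalan_gf"
    by (simp add: algebra_simps)
  with S2 have "(1 - 2 * fps_X * catalan_gf) ^ 2 = 1 - 4 * fps_X"
    by simp
  then have "4 * fps_X * catalan_gf = 4 * fps_X * (1 + fps_X * catalan_gf ^ 2)"
    by (simp add: algebra_simps power2_eq_square)
  then show ?thesis
    by simp
qed

text \<open>The difference of two solutions is killed by a series with constant term \<open>1\<close>.\<close>

lemma catalan_gf_unique:
  assumes "F = 1 + fps_X * F ^ 2"
  shows "F = catalan_gf"
proof -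
  have "(F - catalan_gf) * (1 - fps_X * (F + catalan_gf))
      = (F - (1 + fps_X * F ^ 2)) - (catalan_gf - (1 + fps_X * catalan_gf ^ 2))"
    by (simp add: algebra_simps power2_eq_square)
  also have "\<dots> = 0"
    using assms catalan_gf_eq by simp
  finally have "F - catalan_gf = 0 \<or> 1 - fps_X * (F + catalan_gf) = 0"
    by (simp only: mult_eq_0_iff)
  moreover have "1 - fps_X * (F + catalan_gf) \<noteq> 0"
  proof
    assume "1 - fps_X * (F + catalan_gf) = 0"
    then have "(1 - fps_X * (F + catalan_gf)) $ 0 = 0"
      by (simp only: fps_zero_nth)
    then show False
      by simp
  qed
  ultimately show ?thesis
    by simp
qed

section \<open>Avoiding permutations as binary trees\<close>

datatype tree = Leaf | Node tree tree

fun nodes :: "tree \<Rightarrow> nat" where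
  "nodes Leaf = 0"
| "nodes (Node l r) = Suc (nodes l + nodes r)"

text \<open>
  The root is the largest letter; the left word is shifted above the right one, which is
  what avoidance demands.
\<close>

fun word :: "tree \<Rightarrow> nat list" where
  "word Leaf = []"
| "word (Node l r) = map ((+) (nodes r)) (word l) @ nodes (Node l r) # word r"

lemma avoids_Nil [simp]: "avoids_13_2 []"
  and avoids_single [simp]: "avoids_13_2 [x]"
  by (auto simp: avoids_13_2_def)

text \<open>Turns avoidance into a recursive predicate, so that it can be handled by list induction.\<close>

lemma avoids_Cons_Cons [simp]:
  "avoids_13_2 (x # y # w) \<longleftrightarrow> avoids_13_2 (y # w) \<and> (\<forall>b\<in>set w. \<not> (x < b \<and> b < y))"
proof -
  have "(\<exists>a b. a + 1 < b \<and> b < length (x # y # w)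
            \<and> (x # y # w) ! a < (x # y # w) ! b \<and> (x # y # w) ! b < (x # y # w) ! (a + 1))
      \<longleftrightarrow> (\<exists>i < length w. x < w ! i \<and> w ! i < y) 
        \<or> (\<exists>a b. a + 1 < b \<and> b < length (y # w)
            \<and> (y # w) ! a < (y # w) ! b \<and> (y # w) ! b < (y # w) ! (a + 1))" (is "?L \<longleftrightarrow> ?R1 \<or> ?R2")
  proof
    assume ?L
    then obtain a b where ab: "a + 1 < b" "b < length (x # y # w)"
      "(x # y # w) ! a < (x # y # w) ! b" "(x # y # w) ! b < (x # y # w) ! (a + 1)"
      by blast
    show "?R1 \<or> ?R2"
    proof (cases a)
      case 0
      then have "?R1"
        using ab by (intro exI[of _ "b - 2"]) (auto simp: nth_Cons split: nat.splits)
      then show ?thesis ..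
    next
      case (Suc a')
      then have "?R2"
        using ab by (intro exI[of _ a'] exI[of _ "b - 1"]) (auto simp: nth_Cons split: nat.splits)
      then show ?thesis ..
    qed
  next
    assume "?R1 \<or> ?R2"
    then show ?L
    proof
      assume ?R1
      then obtain i where "i < length w" "x < w ! i" "w ! i < y"
        by blast
      then show ?L
        by (intro exI[of _ 0] exI[of _ "i + 2"]) auto
    next
      assume ?R2
      then obtain a b where "a + 1 < b" "b < length (y # w)"
        "(y # w) ! a < (y # w) ! b" "(y # w) ! b < (y # w) ! (a + 1)"
        by blast
      then show ?L
        by (intro exI[of _ "Suc a"] exI[of _ "Suc b"]) auto
    qed
  qed
  then have "\<not> ?L \<longleftrightarrow> \<not> ?R2 \<and> \<not> ?R1"
    by argo
  moreover have "\<not> ?R1 \<longleftrightarrow> (\<forall>b\<in>set w. \<not> (x < b \<and> b < y))"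
    unfolding all_set_conv_all_nth by blast
  ultimately show ?thesis
    unfolding avoids_13_2_def by argo
qed

lemma avoids_map_add [simp]: "avoids_13_2 (map ((+) c) w) \<longleftrightarrow> avoids_13_2 w"
  unfolding avoids_13_2_def by auto

text \<open>
  Go through \<open>u\<close> from right to left: the last letter of \<open>u\<close> is followed by the maximum and so
  must exceed all of \<open>v\<close>; a letter followed by one that already exceeds all of \<open>v\<close> must do so
  too, since otherwise the pair would jump over a letter of \<open>v\<close>.
\<close>

lemma avoids_split_max:
  assumes "distinct (u @ m # v)" "\<forall>x\<in>set u \<union> set v. x < m"
  shows "avoids_13_2 (u @ m # v)
    \<longleftrightarrow> avoids_13_2 u \<and> avoids_13_2 v \<and> (\<forall>x\<in>set u. \<forall>y\<in>set v. y < x)"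
  using assms
proof (induction u rule: induct_list012)
  case 1
  then show ?case by (cases v) auto
next
  case (2 x)
  then have "avoids_13_2 (m # v) \<longleftrightarrow> avoids_13_2 v"
    by (cases v) auto
  with 2 show ?case
    by (auto simp: not_less_iff_gr_or_eq)
next
  case (3 x y u)
  have "avoids_13_2 ((y # u) @ m # v)
      \<longleftrightarrow> avoids_13_2 (y # u) \<and> avoids_13_2 v \<and> (\<forall>x\<in>set (y # u). \<forall>z\<in>set v. z < x)"
    using 3 by simp
  moreover have "(\<forall>b\<in>set v. \<not> (x < b \<and> b < y)) \<longleftrightarrow> (\<forall>b\<in>set v. b < x)"
    if "\<forall>z\<in>set v. z < y"
  proof -
    have "x \<notin> set v"
      using "3.prems"(1) by simp
    then have "b < x \<longleftrightarrow> \<not> x < b" if "b \<in> set v" for b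
      using that by (metis less_asym linorder_cases)
    with that show ?thesis by blast
  qed
  moreover have "\<not> (x < m \<and> m < y)"
    using "3.prems"(2) by auto
  ultimately show ?case
    by (simp add: ball_Un) blast
qed

lemma length_word [simp]: "length (word t) = nodes t"
  by (induction t) auto

lemma set_word: "set (word t) = {1..nodes t}"
proof (induction t)
  case (Node l r)
  have "(+) (nodes r) ` {1..nodes l} = {nodes r + 1..nodes r + nodes l}"
    by simp
  then show ?case
    using Node by auto
qed auto

lemma distinct_word: "distinct (word t)"
  by (rule card_distinct) (simp add: set_word)

lemma avoids_word: "avoids_13_2 (word t)"
proof (induction t)
  case (Node l r)
  have "\<forall>x\<in>set (map ((+) (nodes r)) (word l)) \<union> set (word r). x < nodes (Node l r)"
    "\<forall>x\<in>set (map ((+) (nodes r)) (word l)). \<forall>y\<in>set (word r). y < x"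
    by (auto simp: set_word)
  then show ?case
    using Node distinct_word[of "Node l r"]
      avoids_split_max[of "map ((+) (nodes r)) (word l)" "nodes (Node l r)" "word r"]
    by (simp only: word.simps avoids_map_add simp_thms)
qed auto

lemma inj_word: "word s = word t \<Longrightarrow> s = t"
proof (induction s arbitrary: t)
  case Leaf
  then show ?case by (cases t) auto
next
  case (Node l r)
  have "nodes t = nodes (Node l r)"
    using Node.prems length_word by metis
  then obtain l' r' where t: "t = Node l' r'" and n: "nodes (Node l' r') = nodes (Node l r)"
    by (cases t) auto
  have "map ((+) (nodes r)) (word l) = map ((+) (nodes r')) (word l') \<and> word r = word r'"
  proof -
    have "word (Node l' r') = map ((+) (nodes r)) (word l) @ nodes (Node l' r') # word r"
      using Node.prems n by (simp only: t word.simps)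
    moreover have "nodes (Node l' r') \<notin> set (map ((+) (nodes r')) (word l'))"
      "nodes (Node l' r') \<notin> set (word r')"
      using distinct_word[of "Node l' r'"] by auto
    ultimately show ?thesis
      unfolding word.simps by (simp only: append_Cons_eq_iff simp_thms)
  qed
  moreover from this have "nodes r = nodes r'"
    using length_word by metis
  ultimately have "word l = word l'" "word r = word r'"
    by (auto simp: inj_map_eq_map)
  then show ?case
    using Node.IH t by blast
qed

text \<open>
  Everything before the maximum exceeds everything after it, so the part after it is an
  avoiding permutation of an initial segment and the part before it is a shifted one.
\<close>

lemma word_surj:
  assumes "set w = {1..length w}" "avoids_13_2 w"
  shows "\<exists>t. word t = w"
  using assms
proof (induction w rule: length_induct)
  case (1 w)
  have dist: "distinct w"
    using 1(2) by (intro card_distinct) simp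
  show ?case
  proof (cases "w = []")
    case True
    then show ?thesis by (metis word.simps(1))
  next
    case False
    then have "length w \<in> set w"
      using 1(2) by (cases w) auto
    then obtain u v where w: "w = u @ length w # v"
      by (meson split_list)
    define n where "n = length w"
    have w: "w = u @ n # v" and n: "n = Suc (length u + length v)"
      using w unfolding n_def by (simp, metis add_Suc_right length_append length_Cons)
    have lt: "\<forall>x\<in>set u \<union> set v. x < n"
      using dist 1(2) unfolding n_def[symmetric] by (auto simp: w order.strict_iff_order)
    have av: "avoids_13_2 u" "avoids_13_2 v" and uv: "\<forall>x\<in>set u. \<forall>y\<in>set v. y < x"
      using avoids_split_max[of u n v] lt dist 1(3) by (auto simp: w)
    have un: "set u \<union> set v = {1..<n}"
      using 1(2) dist unfolding n_def[symmetric] by (force simp: w)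
    have "set u \<inter> set v = {}" "distinct v"
      using dist by (auto simp: w)
    \<comment> \<open>The letters of \<open>v\<close> are downward closed, so each of them is at most their number.\<close>
    have v: "set v = {1..length v}"
    proof (rule card_subset_eq)
      show "set v \<subseteq> {1..length v}"
      proof
        fix y assume y: "y \<in> set v"
        have "{1..y} \<subseteq> set v"
        proof
          fix x assume "x \<in> {1..y}"
          moreover have "y < n"
            using y lt by blast
          ultimately have "x \<in> set u \<union> set v"
            unfolding un by simp
          with \<open>x \<in> {1..y}\<close> show "x \<in> set v"
            using uv y by fastforce
        qed
        then have "card {1..y} \<le> card (set v)"
          by (intro card_mono) auto
        moreover have "1 \<le> y"
          using y un by fastforce
        ultimately show "y \<in> {1..length v}"
          using \<open>distinct v\<close> by (simp add: distinct_card)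
      qed
    qed (use \<open>distinct v\<close> in \<open>simp_all add: distinct_card\<close>)
    have "set u = {1..<n} - set v"
      using un \<open>set u \<inter> set v = {}\<close> by blast
    also have "\<dots> = {length v + 1..length v + length u}"
      unfolding v n by auto
    finally have u: "set u = {length v + 1..length v + length u}" .
    define u' where "u' = map (\<lambda>x. x - length v) u"
    have u': "u = map ((+) (length v)) u'"
      unfolding u'_def map_map by (rule sym, rule map_idI) (simp add: u)
    have set_u': "set u' = {1..length u'}"
    proof -
      have "(+) (length v) ` set u' = set u"
        using arg_cong[OF u', of set] by (simp only: set_map)
      also have "\<dots> = (+) (length v) ` {1..length u'}"
        unfolding u by (simp add: u'_def)
      finally show ?thesis
        by (rule inj_image_eq_iff[THEN iffD1, rotated]) (simp add: inj_def)
    qed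
    have av_u': "avoids_13_2 u'"
      using av(1) avoids_map_add[of "length v" u'] unfolding u'[symmetric] by blast
    have len: "length u' < length w" "length v < length w"
      by (simp_all add: w u'_def)
    have "\<exists>l. word l = u'" "\<exists>r. word r = v"
      using 1(1)[rule_format, OF len(1) set_u' av_u'] 1(1)[rule_format, OF len(2) v av(2)] .
    then obtain l r where lr: "word l = u'" "word r = v"
      by blast
    then have "nodes r = length v" "nodes l = length u"
      using length_word[of l] length_word[of r] by (simp_all add: u'_def)
    then have "word (Node l r) = w"
      unfolding w u' word.simps lr nodes.simps n by (simp add: u'_def)
    then show ?thesis ..
  qed
qed

section \<open>Statistics of a tree\<close>

fun mirror :: "tree \<Rightarrow> tree" where
  "mirror Leaf = Leaf"
| "mirror (Node l r) = Node (mirror r) (mirror l)"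

lemma nodes_mirror [simp]: "nodes (mirror t) = nodes t"
  by (induction t) auto

lemma mirror_mirror [simp]: "mirror (mirror t) = t"
  by (induction t) auto

text \<open>The tree of the identity permutation; its mirror image gives the decreasing one.\<close>

fun left_comb :: "nat \<Rightarrow> tree" where
  "left_comb 0 = Leaf"
| "left_comb (Suc k) = Node (left_comb k) Leaf"

lemma nodes_left_comb [simp]: "nodes (left_comb k) = k"
  by (induction k) auto

lemma nodes_eq_0_iff [simp]: "nodes t = 0 \<longleftrightarrow> t = Leaf"
  by (cases t) auto

lemma begins_0 [simp]: "begins_incr 0 w" "begins_decr 0 w"
  by (simp_all add: begins_incr_def begins_decr_def)

lemma ends_0 [simp]: "ends_incr 0 w" "ends_decr 0 w"
  by (simp_all add: ends_incr_def ends_decr_def)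

lemma not_begins_Suc_Nil [simp]: "\<not> begins_incr (Suc k) []" "\<not> begins_decr (Suc k) []"
  by (simp_all add: begins_incr_def begins_decr_def)

lemma not_ends_Suc_Nil [simp]: "\<not> ends_incr (Suc k) []" "\<not> ends_decr (Suc k) []"
  by (simp_all add: ends_incr_def ends_decr_def)

lemma begins_map_add [simp]:
  "begins_incr k (map ((+) (c::nat)) w) \<longleftrightarrow> begins_incr k w"
  "begins_decr k (map ((+) c) w) \<longleftrightarrow> begins_decr k w"
  by (simp_all add: begins_incr_def begins_decr_def take_map sorted_wrt_map)

text \<open>
  Reversing a word keeps the splitting at the maximum, so facts on endings follow from facts on
  beginnings.
\<close>

lemma ends_conv_begins_rev:
  "ends_decr k w \<longleftrightarrow> begins_incr k (rev w)"
  "ends_incr k w \<longleftrightarrow> begins_decr k (rev w)"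
  by (auto simp: begins_incr_def begins_decr_def ends_incr_def ends_decr_def take_rev sorted_wrt_rev)

lemma begins_incr_split_max:
  assumes "\<forall>x\<in>set u \<union> set v. x < m"
  shows "begins_incr (Suc k) (u @ m # v)
    \<longleftrightarrow> begins_incr (Suc k) u \<or> length u = k \<and> begins_incr k u"
proof -
  consider "k < length u" | "k = length u" | d where "k = Suc (length u + d)"
    by (metis less_imp_Suc_add nat_neq_iff)
  then show ?thesis
  proof cases
    case 2
    then show ?thesis
      using assms by (auto simp: begins_incr_def sorted_wrt_append)
  next
    case 3
    \<comment> \<open>A run that gets past the maximum would have to continue above it.\<close>
    then show ?thesis
      using assms by (cases v) (auto simp: begins_incr_def sorted_wrt_append)
  qed (auto simp: begins_incr_def)
qed

text \<open>
  A decreasing run can contain the maximum only as its first letter.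
\<close>

lemma begins_decr_split_max:
  assumes "\<forall>x\<in>set u \<union> set v. x < m"
  shows "begins_decr (Suc k) (u @ m # v)
    \<longleftrightarrow> (if u = [] then begins_decr k v else begins_decr (Suc k) u)"
proof (cases "k < length u")
  case True
  then show ?thesis
    by (auto simp: begins_decr_def)
next
  case False
  then obtain d where "k = length u + d"
    using le_Suc_ex not_less by blast
  then show ?thesis
    using assms by (cases u) (auto simp: begins_decr_def sorted_wrt_append dest: in_set_takeD)
qed

lemma
  fixes l r :: tree
  shows begins_incr_Node: "begins_incr (Suc k) (word (Node l r))
      \<longleftrightarrow> begins_incr (Suc k) (word l) \<or> nodes l = k \<and> begins_incr k (word l)"
    and ends_decr_Node: "ends_decr (Suc k) (word (Node l r))
      \<longleftrightarrow> ends_decr (Suc k) (word r) \<or> nodes r = k \<and> ends_decr k (word r)"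
    and begins_decr_Node: "begins_decr (Suc k) (word (Node l r))
      \<longleftrightarrow> (if l = Leaf then begins_decr k (word r) else begins_decr (Suc k) (word l))"
    and ends_incr_Node: "ends_incr (Suc k) (word (Node l r))
      \<longleftrightarrow> (if r = Leaf then ends_incr k (word l) else ends_incr (Suc k) (word r))"
proof -
  define u where "u = map ((+) (nodes r)) (word l)"
  have lt: "\<forall>x\<in>set u \<union> set (word r). x < nodes (Node l r)"
    by (auto simp: set_word u_def)
  then have lt': "\<forall>x\<in>set (rev (word r)) \<union> set (rev u). x < nodes (Node l r)"
    by auto
  have u: "word (Node l r) = u @ nodes (Node l r) # word r"
    "rev (word (Node l r)) = rev (word r) @ nodes (Node l r) # rev u"
    by (simp_all add: u_def)
  have [simp]: "length u = nodes l" "u = [] \<longleftrightarrow> l = Leaf" "word r = [] \<longleftrightarrow> r = Leaf"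
    using length_word[of r] by (auto simp: u_def simp flip: length_0_conv)
  have [simp]: "begins_incr j u \<longleftrightarrow> begins_incr j (word l)"
    "begins_decr j u \<longleftrightarrow> begins_decr j (word l)"
    "begins_decr j (rev u) \<longleftrightarrow> begins_decr j (rev (word l))" for j
    by (simp_all add: u_def rev_map)
  show "begins_incr (Suc k) (word (Node l r))
      \<longleftrightarrow> begins_incr (Suc k) (word l) \<or> nodes l = k \<and> begins_incr k (word l)"
    unfolding u(1) begins_incr_split_max[OF lt] by simp
  show "ends_decr (Suc k) (word (Node l r))
      \<longleftrightarrow> ends_decr (Suc k) (word r) \<or> nodes r = k \<and> ends_decr k (word r)"
    unfolding ends_conv_begins_rev u(2) begins_incr_split_max[OF lt'] by simp
  show "begins_decr (Suc k) (word (Node l r))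
      \<longleftrightarrow> (if l = Leaf then begins_decr k (word r) else begins_decr (Suc k) (word l))"
    unfolding u(1) begins_decr_split_max[OF lt] by simp
  show "ends_incr (Suc k) (word (Node l r))
      \<longleftrightarrow> (if r = Leaf then ends_incr k (word l) else ends_incr (Suc k) (word r))"
    unfolding ends_conv_begins_rev u(2) begins_decr_split_max[OF lt'] by simp
qed

text \<open>
  The word of the mirrored tree is in general not the reversed word, but the recursions for the
  runs at the two ends are exchanged when left and right are.
\<close>

lemma ends_decr_mirror: "ends_decr k (word (mirror t)) \<longleftrightarrow> begins_incr k (word t)"
proof (induction t arbitrary: k)
  case Leaf
  then show ?case by (cases k) auto
next
  case (Node l r)
  then show ?case
    by (cases k) (auto simp: begins_incr_Node ends_decr_Node simp del: word.simps(2))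
qed

lemma ends_incr_mirror: "ends_incr k (word (mirror t)) \<longleftrightarrow> begins_decr k (word t)"
proof (induction t arbitrary: k)
  case Leaf
  then show ?case by (cases k) auto
next
  case (Node l r)
  have "mirror l = Leaf \<longleftrightarrow> l = Leaf"
    by (metis mirror.simps(1) mirror_mirror)
  with Node show ?case
    by (cases k) (auto simp: begins_decr_Node ends_incr_Node simp del: word.simps(2))
qed

lemma begins_incr_le_nodes: "begins_incr k (word t) \<Longrightarrow> k \<le> nodes t"
  by (simp add: begins_incr_def)

text \<open>
  Identifies the exceptional left subtrees, those with an entirely increasing word: there is
  exactly one of each size.
\<close>

lemma left_comb_iff: "nodes t = k \<and> begins_incr k (word t) \<longleftrightarrow> t = left_comb k"
proof (induction k arbitrary: t)
  case 0
  then show ?case by simp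
next
  case (Suc k)
  show ?case
  proof (cases t)
    case (Node l r)
    have "nodes t = Suc k \<and> begins_incr (Suc k) (word t)
        \<longleftrightarrow> r = Leaf \<and> nodes l = k \<and> begins_incr k (word l)"
      unfolding Node begins_incr_Node using begins_incr_le_nodes[of "Suc k" l] by auto
    then show ?thesis
      using Suc.IH by (simp add: Node) blast
  qed simp
qed

lemma begins_incr_Node_comb:
  "begins_incr (Suc k) (word (Node l r)) \<longleftrightarrow> begins_incr (Suc k) (word l) \<or> l = left_comb k"
  unfolding begins_incr_Node left_comb_iff ..

lemma ends_decr_Node_comb:
  "ends_decr (Suc k) (word (Node l r)) \<longleftrightarrow> ends_decr (Suc k) (word r) \<or> r = mirror (left_comb k)"
proof -
  have "nodes r = k \<and> ends_decr k (word r) \<longleftrightarrow> mirror r = left_comb k"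
    using left_comb_iff[of "mirror r" k] ends_decr_mirror[of k "mirror r"] by simp
  also have "\<dots> \<longleftrightarrow> r = mirror (left_comb k)"
    by (metis mirror_mirror)
  finally show ?thesis
    unfolding ends_decr_Node by simp
qed

lemma not_begins_incr_left_comb [simp]: "\<not> begins_incr (Suc k) (word (left_comb k))"
  using begins_incr_le_nodes[of "Suc k" "left_comb k"] by auto

lemma ends_incr_left_comb: "ends_incr l (word (left_comb k)) \<longleftrightarrow> l \<le> k"
proof (induction k arbitrary: l)
  case 0
  then show ?case by (cases l) auto
next
  case (Suc k)
  then show ?case
    by (cases l) (auto simp: ends_incr_Node simp del: word.simps(2))
qed

section \<open>Generating functions of sets of trees\<close>

definition tree_gf :: "(tree \<Rightarrow> bool) \<Rightarrow> real fps" where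
  "tree_gf P = Abs_fps (\<lambda>n. of_nat (card {t. nodes t = n \<and> P t}))"

lemma word_bij: "bij_betw word {t. nodes t = n} {w \<in> permutations_of_set {1..n}. avoids_13_2 w}"
proof (rule bij_betwI')
  fix s t
  show "word s = word t \<longleftrightarrow> s = t"
    using inj_word by blast
next
  fix t assume "t \<in> {t. nodes t = n}"
  then show "word t \<in> {w \<in> permutations_of_set {1..n}. avoids_13_2 w}"
    by (auto simp: permutations_of_set_def set_word distinct_word avoids_word)
next
  fix w assume w: "w \<in> {w \<in> permutations_of_set {1..n}. avoids_13_2 w}"
  then have "length w = n"
    by (auto simp: length_finite_permutations_of_set)
  moreover from this obtain t where "word t = w"
    using w word_surj[of w] by (auto simp: permutations_of_set_def)
  ultimately show "\<exists>t\<in>{t. nodes t = n}. w = word t"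
    by (auto intro!: bexI[of _ t])
qed

lemma finite_trees [simp]: "finite {t. nodes t = n \<and> P t}"
proof -
  have "finite {t. nodes t = n}"
    using bij_betw_finite[OF word_bij] by simp
  then show ?thesis
    by (rule rev_finite_subset) auto
qed

lemma perm_gf_eq_tree_gf:
  "perm_gf avoids_13_2 q r = tree_gf (\<lambda>t. t \<noteq> Leaf \<and> q (word t) \<and> r (word t))"
proof (rule fps_ext)
  fix n
  show "perm_gf avoids_13_2 q r $ n
      = tree_gf (\<lambda>t. t \<noteq> Leaf \<and> q (word t) \<and> r (word t)) $ n"
  proof (cases "n = 0")
    case True
    then show ?thesis by (auto simp: perm_gf_def tree_gf_def card_eq_0_iff)
  next
    case False
    have "bij_betw word {t. nodes t = n \<and> q (word t) \<and> r (word t)}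
      {w \<in> permutations_of_set {1..n}. avoids_13_2 w \<and> q w \<and> r w}"
      using word_bij[of n] unfolding bij_betw_def inj_on_def by auto
    then have "card {t. nodes t = n \<and> q (word t) \<and> r (word t)} = perm_count avoids_13_2 q r n"
      unfolding perm_count_def by (rule bij_betw_same_card)
    moreover have "{t. nodes t = n \<and> q (word t) \<and> r (word t)}
        = {t. nodes t = n \<and> t \<noteq> Leaf \<and> q (word t) \<and> r (word t)}"
      using False by auto
    ultimately show ?thesis
      using False by (simp add: perm_gf_def tree_gf_def)
  qed
qed

lemma tree_gf_disj:
  assumes "\<And>t. \<not> (P t \<and> Q t)"
  shows "tree_gf (\<lambda>t. P t \<or> Q t) = tree_gf P + tree_gf Q"
proof (rule fps_ext)
  fix n
  have "{t. nodes t = n \<and> (P t \<or> Q t)} = {t. nodes t = n \<and> P t} \<union> {t. nodes t = n \<and> Q t}"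
    by auto
  moreover have "card \<dots> = card {t. nodes t = n \<and> P t} + card {t. nodes t = n \<and> Q t}"
    by (rule card_Un_disjoint) (use assms in auto)
  ultimately show "tree_gf (\<lambda>t. P t \<or> Q t) $ n = (tree_gf P + tree_gf Q) $ n"
    by (simp add: tree_gf_def)
qed

lemma tree_gf_singleton: "tree_gf (\<lambda>t. t = s) = fps_X ^ nodes s"
proof (rule fps_ext)
  fix n
  have "{t. nodes t = n \<and> t = s} = (if n = nodes s then {s} else {})"
    by auto
  then show "tree_gf (\<lambda>t. t = s) $ n = (fps_X ^ nodes s) $ n"
    by (simp add: tree_gf_def)
qed

lemma tree_gf_False [simp]: "tree_gf (\<lambda>t. False) = 0"
  by (rule fps_ext) (simp add: tree_gf_def)

lemma tree_gf_mirror: "tree_gf (\<lambda>t. P (mirror t)) = tree_gf P"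
proof (rule fps_ext)
  fix n
  have "bij_betw mirror {t. nodes t = n \<and> P (mirror t)} {t. nodes t = n \<and> P t}"
    by (rule bij_betwI[where g = mirror]) auto
  then show "tree_gf (\<lambda>t. P (mirror t)) $ n = tree_gf P $ n"
    by (simp add: tree_gf_def bij_betw_same_card)
qed

text \<open>
  The set of trees obtained by joining, under a new root, a left subtree from \<open>P\<close> and a right
  subtree from \<open>Q\<close>.
\<close>

definition Node_of :: "(tree \<Rightarrow> bool) \<Rightarrow> (tree \<Rightarrow> bool) \<Rightarrow> tree \<Rightarrow> bool" where
  "Node_of P Q t \<longleftrightarrow> (\<exists>l r. t = Node l r \<and> P l \<and> Q r)"

lemma Node_of_simps [simp]:
  "\<not> Node_of P Q Leaf"
  "Node_of P Q (Node l r) \<longleftrightarrow> P l \<and> Q r"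
  by (auto simp: Node_of_def)

lemma tree_gf_Node_of: "tree_gf (Node_of P Q) = fps_X * tree_gf P * tree_gf Q"
proof (rule fps_ext)
  fix n
  show "tree_gf (Node_of P Q) $ n = (fps_X * tree_gf P * tree_gf Q) $ n"
  proof (cases n)
    case 0
    then show ?thesis
      by (auto simp: tree_gf_def card_eq_0_iff mult.assoc)
  next
    case (Suc m)
    define A where "A i = {l. nodes l = i \<and> P l}" for i
    define B where "B i = {r. nodes r = i \<and> Q r}" for i
    have [simp]: "finite (A i)" "finite (B i)" for i
      by (simp_all add: A_def B_def)
    have "{t. nodes t = Suc m \<and> Node_of P Q t}
        = (\<Union>i\<in>{0..m}. (\<lambda>(l, r). Node l r) ` (A i \<times> B (m - i)))"
      by (force simp: Node_of_def A_def B_def)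
    also have "card \<dots> = (\<Sum>i=0..m. card ((\<lambda>(l, r). Node l r) ` (A i \<times> B (m - i))))"
      by (rule card_UN_disjoint) (auto simp: A_def)
    also have "\<dots> = (\<Sum>i=0..m. card (A i) * card (B (m - i)))"
      by (simp add: card_image inj_on_def card_cartesian_product)
    finally have "tree_gf (Node_of P Q) $ n = (tree_gf P * tree_gf Q) $ m"
      by (simp add: Suc fps_mult_nth tree_gf_def A_def B_def)
    also have "\<dots> = (fps_X * tree_gf P * tree_gf Q) $ n"
      by (simp only: Suc mult.assoc fps_X_mult_nth) simp
    finally show ?thesis .
  qed
qed

lemma tree_gf_True: "tree_gf (\<lambda>t. True) = catalan_gf"
proof (rule catalan_gf_unique)
  have "tree_gf (\<lambda>t. True) = tree_gf (\<lambda>t. t = Leaf \<or> Node_of (\<lambda>t. True) (\<lambda>t. True) t)"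
    by (rule arg_cong[of _ _ tree_gf], rule ext) (metis Node_of_simps(2) tree.exhaust)
  also have "\<dots> = 1 + fps_X * tree_gf (\<lambda>t. True) ^ 2"
    by (subst tree_gf_disj) (auto simp: tree_gf_singleton tree_gf_Node_of power2_eq_square mult_ac)
  finally show "tree_gf (\<lambda>t. True) = 1 + fps_X * tree_gf (\<lambda>t. True) ^ 2" .
qed

section \<open>The four families\<close>

abbreviation (input) C :: "real fps" where "C \<equiv> catalan_gf"

lemma catalan_power_step:
  "fps_X ^ i * C ^ Suc j = fps_X ^ i * C ^ j + fps_X ^ Suc i * C ^ (j + 2)"
proof -
  have "fps_X ^ i * C ^ Suc j = fps_X ^ i * C ^ j * (1 + fps_X * C ^ 2)"
    using catalan_gf_eq by (simp add: mult_ac)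
  also have "\<dots> = fps_X ^ i * C ^ j + fps_X ^ Suc i * C ^ (j + 2)"
    by (simp add: algebra_simps power2_eq_square)
  finally show ?thesis .
qed

text \<open>
  This is \<open>1 / (1 - x C) = C\<close>. The term \<open>x C F\<close> stands for the trees whose run lies in one
  subtree of the root, the other subtree being arbitrary.
\<close>

lemma eq_geometric_solution:
  assumes "F = A + fps_X * C * F"
  shows "F = A * C"
proof -
  have "C * F = C * A + (fps_X * C ^ 2) * F"
    using arg_cong[OF assms, of "(*) C"] by (simp add: algebra_simps power2_eq_square)
  moreover have "fps_X * C ^ 2 = C - 1"
    using catalan_gf_eq by (simp add: algebra_simps)
  ultimately show ?thesis
    by (simp add: algebra_simps)
qed

text \<open>
  The left subtree either has the run itself or is the comb of size \<open>k\<close>, which the root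
  completes; both series are needed below, the second one as the weight of the left subtree.
\<close>

lemma begins_incr_gf:
  "tree_gf (\<lambda>t. begins_incr (Suc k) (word t)) = fps_X ^ Suc k * C ^ 2" (is ?A)
  and begins_incr_or_comb_gf:
  "tree_gf (\<lambda>t. begins_incr (Suc k) (word t) \<or> t = left_comb k) = fps_X ^ k * C" (is ?B)
proof -
  let ?I = "tree_gf (\<lambda>t. begins_incr (Suc k) (word t))"
  have or: "tree_gf (\<lambda>t. begins_incr (Suc k) (word t) \<or> t = left_comb k) = ?I + fps_X ^ k"
    by (subst tree_gf_disj) (auto simp: tree_gf_singleton)
  have "(\<lambda>t. begins_incr (Suc k) (word t))
      = Node_of (\<lambda>l. begins_incr (Suc k) (word l) \<or> l = left_comb k) (\<lambda>r. True)"
  proof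
    fix t
    show "begins_incr (Suc k) (word t)
      = Node_of (\<lambda>l. begins_incr (Suc k) (word l) \<or> l = left_comb k) (\<lambda>r. True) t"
      by (cases t) (simp_all add: begins_incr_Node_comb del: word.simps(2))
  qed
  then have I: "?I = fps_X * (?I + fps_X ^ k) * C"
    by (metis tree_gf_Node_of or tree_gf_True)
  then have "?I = fps_X ^ Suc k * C + fps_X * C * ?I"
    by (simp add: algebra_simps)
  from eq_geometric_solution[OF this] show A: ?A
    by (simp add: power2_eq_square mult.assoc)
  have "?I + fps_X ^ k = fps_X ^ k * (1 + fps_X * C ^ 2)"
    unfolding A by (simp add: algebra_simps)
  then show ?B
    unfolding or using catalan_gf_eq by simp
qed

lemma ends_decr_or_comb_gf:
  "tree_gf (\<lambda>t. ends_decr (Suc k) (word t) \<or> t = mirror (left_comb k)) = fps_X ^ k * C"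
proof -
  have "(\<lambda>t. ends_decr (Suc k) (word t) \<or> t = mirror (left_comb k))
      = (\<lambda>t. begins_incr (Suc k) (word (mirror t)) \<or> mirror t = left_comb k)"
    by (metis ends_decr_mirror mirror_mirror)
  then show ?thesis
    using tree_gf_mirror[of "\<lambda>t. begins_incr (Suc k) (word t) \<or> t = left_comb k"]
    by (simp add: begins_incr_or_comb_gf)
qed

lemma ends_incr_gf: "tree_gf (\<lambda>t. ends_incr l (word t)) = fps_X ^ l * C ^ Suc l"
proof (induction l)
  case 0
  then show ?case by (simp add: tree_gf_True)
next
  case (Suc l)
  let ?J = "\<lambda>l. tree_gf (\<lambda>t. ends_incr l (word t))"
  have "(\<lambda>t. ends_incr (Suc l) (word t))
      = (\<lambda>t. Node_of (\<lambda>u. ends_incr l (word u)) (\<lambda>r. r = Leaf) t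
          \<or> Node_of (\<lambda>u. True) (\<lambda>r. ends_incr (Suc l) (word r)) t)"
  proof
    fix t
    show "ends_incr (Suc l) (word t)
      = (Node_of (\<lambda>u. ends_incr l (word u)) (\<lambda>r. r = Leaf) t
          \<or> Node_of (\<lambda>u. True) (\<lambda>r. ends_incr (Suc l) (word r)) t)"
      by (cases t) (auto simp: ends_incr_Node simp del: word.simps(2))
  qed
  then have "?J (Suc l)
      = tree_gf (\<lambda>t. Node_of (\<lambda>u. ends_incr l (word u)) (\<lambda>r. r = Leaf) t
          \<or> Node_of (\<lambda>u. True) (\<lambda>r. ends_incr (Suc l) (word r)) t)"
    by (rule arg_cong)
  also have "\<dots> = tree_gf (Node_of (\<lambda>u. ends_incr l (word u)) (\<lambda>r. r = Leaf))
        + tree_gf (Node_of (\<lambda>u. True) (\<lambda>r. ends_incr (Suc l) (word r)))"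
    by (rule tree_gf_disj) (auto simp: Node_of_def)
  also have "\<dots> = fps_X * ?J l + fps_X * C * ?J (Suc l)"
    by (simp add: tree_gf_Node_of tree_gf_True tree_gf_singleton)
  finally have "?J (Suc l) = fps_X * ?J l * C"
    by (rule eq_geometric_solution)
  then show ?case
    using Suc by (simp add: mult_ac)
qed

lemma begins_decr_gf: "tree_gf (\<lambda>t. begins_decr k (word t)) = fps_X ^ k * C ^ Suc k"
  using tree_gf_mirror[of "\<lambda>t. ends_incr k (word t)"] by (simp add: ends_incr_mirror ends_incr_gf)

text \<open>The two conditions concern different subtrees, so the series is a product.\<close>

lemma begins_incr_ends_decr_gf:
  "tree_gf (\<lambda>t. begins_incr (Suc k) (word t) \<and> ends_decr (Suc l) (word t))
    = fps_X ^ (k + l + 1) * C ^ 2"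
proof -
  have "(\<lambda>t. begins_incr (Suc k) (word t) \<and> ends_decr (Suc l) (word t))
      = Node_of (\<lambda>u. begins_incr (Suc k) (word u) \<or> u = left_comb k)
          (\<lambda>r. ends_decr (Suc l) (word r) \<or> r = mirror (left_comb l))"
  proof
    fix t
    show "(begins_incr (Suc k) (word t) \<and> ends_decr (Suc l) (word t))
      = Node_of (\<lambda>u. begins_incr (Suc k) (word u) \<or> u = left_comb k)
          (\<lambda>r. ends_decr (Suc l) (word r) \<or> r = mirror (left_comb l)) t"
      by (cases t) (simp_all add: begins_incr_Node_comb ends_decr_Node_comb del: word.simps(2))
  qed
  then have "tree_gf (\<lambda>t. begins_incr (Suc k) (word t) \<and> ends_decr (Suc l) (word t))
      = fps_X * (fps_X ^ k * C) * (fps_X ^ l * C)"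
    by (simp only: tree_gf_Node_of begins_incr_or_comb_gf ends_decr_or_comb_gf)
  then show ?thesis
    by (simp add: power_add power2_eq_square mult_ac)
qed

text \<open>
  Induction on \<open>l\<close>, by the right subtree: if it is not empty, it carries the final run alone;
  if it is empty, the root is the last letter of that run, and the left subtree must either
  satisfy both conditions with \<open>l\<close> decreased or be the comb of size \<open>k\<close>. The comb is the
  source of the additional powers of \<open>x\<close>.
\<close>

lemma begins_incr_ends_incr_gf:
  "tree_gf (\<lambda>t. begins_incr (Suc k) (word t) \<and> ends_incr (Suc l) (word t))
    = fps_X ^ (k + l + 1) * C ^ (l + 2) + (\<Sum>i = max (Suc k) (Suc l)..<k + l + 1. fps_X ^ i)"
    (is "?G (Suc l) = ?F l")
proof -
  have step: "?G (Suc l) = fps_X ^ (k + l + 2) * C ^ (l + 3) + fps_X * ?G l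
      + (if l \<le> k then fps_X ^ Suc k else 0)" for l
  proof -
    let ?P1 = "Node_of (\<lambda>u. begins_incr (Suc k) (word u) \<or> u = left_comb k)
          (\<lambda>r. ends_incr (Suc l) (word r))"
    let ?P2 = "Node_of (\<lambda>u. begins_incr (Suc k) (word u) \<and> ends_incr l (word u)) (\<lambda>r. r = Leaf)"
    let ?P3 = "\<lambda>t. t = left_comb (Suc k) \<and> l \<le> k"
    have "(\<lambda>t. begins_incr (Suc k) (word t) \<and> ends_incr (Suc l) (word t))
        = (\<lambda>t. (?P1 t \<or> ?P2 t) \<or> ?P3 t)"
    proof
      fix t
      show "(begins_incr (Suc k) (word t) \<and> ends_incr (Suc l) (word t))
        = ((?P1 t \<or> ?P2 t) \<or> ?P3 t)"
        by (cases t) (auto simp: begins_incr_Node_comb ends_incr_Node ends_incr_left_comb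
            simp del: word.simps(2))
    qed
    then have "?G (Suc l) = tree_gf (\<lambda>t. (?P1 t \<or> ?P2 t) \<or> ?P3 t)"
      by (rule arg_cong)
    also have "\<dots> = tree_gf (\<lambda>t. ?P1 t \<or> ?P2 t) + tree_gf ?P3"
      by (rule tree_gf_disj) auto
    also have "tree_gf (\<lambda>t. ?P1 t \<or> ?P2 t) = tree_gf ?P1 + tree_gf ?P2"
      by (rule tree_gf_disj) (auto simp: Node_of_def)
    also have "tree_gf ?P1 = fps_X ^ (k + l + 2) * C ^ (l + 3)"
      by (simp add: tree_gf_Node_of begins_incr_or_comb_gf ends_incr_gf power_add
          power3_eq_cube mult_ac power2_eq_square)
    also have "tree_gf ?P2 = fps_X * ?G l"
      by (simp add: tree_gf_Node_of tree_gf_singleton)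
    also have "tree_gf ?P3 = (if l \<le> k then fps_X ^ Suc k else 0)"
      using tree_gf_singleton[of "left_comb (Suc k)"] by simp
    finally show ?thesis .
  qed
  show ?thesis
  proof (induction l)
    case 0
    have "ends_incr (Suc 0) w \<longleftrightarrow> w \<noteq> []" for w
      by (cases w rule: rev_cases) (auto simp: ends_incr_def)
    then have "begins_incr (Suc k) w \<and> ends_incr (Suc 0) w \<longleftrightarrow> begins_incr (Suc k) w" for w
      by (metis not_begins_Suc_Nil(1))
    then show ?case
      by (simp only: begins_incr_gf) (simp add: power2_eq_square)
  next
    case (Suc l)
    let ?m = "max (Suc k) (Suc l)"
    have shift: "fps_X * (\<Sum>i = ?m..<k + l + 1. fps_X ^ i :: real fps)
        = (\<Sum>i = Suc ?m..<k + Suc l + 1. fps_X ^ i)"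
    proof -
      have "fps_X * (\<Sum>i = ?m..<k + l + 1. fps_X ^ i :: real fps)
        = (\<Sum>i = Suc ?m..<Suc (k + l + 1). fps_X ^ i)"
        by (simp only: sum_distrib_left sum.shift_bounds_Suc_ivl power_Suc)
      also have "Suc (k + l + 1) = k + Suc l + 1"
        by simp
      finally show ?thesis .
    qed
    have extend: "(\<Sum>i = max (Suc k) (Suc (Suc l))..<k + Suc l + 1. fps_X ^ i :: real fps)
        = (if Suc l \<le> k then fps_X ^ Suc k else 0) + (\<Sum>i = Suc ?m..<k + Suc l + 1. fps_X ^ i)"
    proof (cases "Suc l \<le> k")
      case True
      then have "?m = Suc k" "max (Suc k) (Suc (Suc l)) = Suc k"
        by simp_all
      then show ?thesis
        using True by (simp only: if_True) (rule sum.atLeast_Suc_lessThan, simp)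
    next
      case False
      then have "Suc ?m = max (Suc k) (Suc (Suc l))"
        by simp
      with False show ?thesis
        by (simp only: if_False add_0_left)
    qed
    have power: "fps_X ^ (k + Suc l + 1) * C ^ (Suc l + 2)
        = fps_X ^ (k + Suc l + 2) * C ^ (Suc l + 3) + fps_X * (fps_X ^ (k + l + 1) * C ^ (l + 2))"
      using catalan_power_step[of "k + l + 2" "l + 2"] by (simp add: eval_nat_numeral mult_ac add_ac)
    show ?case
      unfolding step[of "Suc l"] Suc.IH distrib_left shift extend power by (simp only: add_ac)
  qed
qed

lemma begins_decr_ends_decr_gf:
  "tree_gf (\<lambda>t. begins_decr l (word t) \<and> ends_decr k (word t))
    = tree_gf (\<lambda>t. begins_incr k (word t) \<and> ends_incr l (word t))"
proof -
  have "begins_decr l (word t) \<and> ends_decr k (word t)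
      \<longleftrightarrow> begins_incr k (word (mirror t)) \<and> ends_incr l (word (mirror t))" for t
    by (metis ends_decr_mirror ends_incr_mirror mirror_mirror)
  then show ?thesis
    using tree_gf_mirror[of "\<lambda>t. begins_incr k (word t) \<and> ends_incr l (word t)"] by simp
qed

lemma perm_gf_begins_incr:
  "perm_gf avoids_13_2 (begins_incr (Suc k)) r
    = tree_gf (\<lambda>t. begins_incr (Suc k) (word t) \<and> r (word t))"
  unfolding perm_gf_eq_tree_gf by (rule arg_cong[of _ _ tree_gf], rule ext) auto

lemma perm_gf_ends_decr:
  "perm_gf avoids_13_2 q (ends_decr (Suc l))
    = tree_gf (\<lambda>t. q (word t) \<and> ends_decr (Suc l) (word t))"
  unfolding perm_gf_eq_tree_gf by (rule arg_cong[of _ _ tree_gf], rule ext) auto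

lemma geometric_block:
  assumes "m \<le> n"
  shows "(fps_X ^ m - fps_X ^ n) / (1 - fps_X) = (\<Sum>i = m..<n. fps_X ^ i :: real fps)"
proof -
  have "(\<Sum>i = m..<m + d. fps_X ^ i :: real fps) * (1 - fps_X) = fps_X ^ m - fps_X ^ (m + d)"
    for d
  proof (induction d)
    case (Suc d)
    have "(\<Sum>i = m..<m + Suc d. fps_X ^ i :: real fps) * (1 - fps_X)
        = (\<Sum>i = m..<m + d. fps_X ^ i) * (1 - fps_X) + (fps_X ^ (m + d) - fps_X ^ Suc (m + d))"
      by (simp add: algebra_simps)
    then show ?case
      unfolding Suc.IH by simp
  qed simp
  from this[of "n - m"] have "(\<Sum>i = m..<n. fps_X ^ i :: real fps) * (1 - fps_X) = fps_X ^ m - fps_X ^ n"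
    using assms by simp
  moreover have "(1 - fps_X :: real fps) \<noteq> 0"
    by (metis diff_eq_diff_eq diff_zero fps_X_neq_one)
  ultimately show ?thesis
    by (metis nonzero_mult_div_cancel_right)
qed

section \<open>The trivariate series\<close>

definition decr_incr_gf :: "nat \<Rightarrow> nat \<Rightarrow> real fps" where
  "decr_incr_gf k l = perm_gf avoids_13_2 (begins_decr k) (ends_incr l)"

lemma decr_incr_gf_eq_tree_gf:
  "decr_incr_gf k l = tree_gf (\<lambda>t. t \<noteq> Leaf \<and> begins_decr k (word t) \<and> ends_incr l (word t))"
  by (simp add: decr_incr_gf_def perm_gf_eq_tree_gf)

lemma decr_incr_gf_0_0: "decr_incr_gf 0 0 = C - 1"
proof -
  have "C = tree_gf (\<lambda>t. t = Leaf \<or> t \<noteq> Leaf)"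
    by (simp add: tree_gf_True)
  also have "\<dots> = 1 + tree_gf (\<lambda>t. t \<noteq> Leaf)"
    by (subst tree_gf_disj) (auto simp: tree_gf_singleton)
  finally have "tree_gf (\<lambda>t. t \<noteq> Leaf) = C - 1"
    by (metis add_diff_cancel_left')
  then show ?thesis
    by (simp add: decr_incr_gf_eq_tree_gf)
qed

lemma decr_incr_gf_Suc_0: "decr_incr_gf (Suc k) 0 = fps_X ^ Suc k * C ^ (k + 2)"
proof -
  have "decr_incr_gf (Suc k) 0 = tree_gf (\<lambda>t. begins_decr (Suc k) (word t))"
    unfolding decr_incr_gf_eq_tree_gf by (rule arg_cong[of _ _ tree_gf], rule ext) auto
  then show ?thesis
    by (simp add: begins_decr_gf)
qed

lemma decr_incr_gf_0_Suc: "decr_incr_gf 0 (Suc l) = fps_X ^ Suc l * C ^ (l + 2)"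
proof -
  have "decr_incr_gf 0 (Suc l) = tree_gf (\<lambda>t. ends_incr (Suc l) (word t))"
    unfolding decr_incr_gf_eq_tree_gf by (rule arg_cong[of _ _ tree_gf], rule ext) auto
  then show ?thesis
    by (simp add: ends_incr_gf)
qed

text \<open>
  Four cases, according to which subtrees of the root are empty. If both are not, the runs
  are independent; if exactly one is, the root belongs to the run on that side, and the other
  subtree carries both remaining runs.
\<close>

lemma decr_incr_gf_Suc_Suc:
  "decr_incr_gf (Suc k) (Suc l)
    = fps_X ^ (k + l + 3) * C ^ (k + l + 4) + fps_X * decr_incr_gf k (Suc l)
      + fps_X * decr_incr_gf (Suc k) l + (if k = 0 \<and> l = 0 then fps_X else 0)"
proof -
  let ?P1 = "Node_of (\<lambda>u. begins_decr (Suc k) (word u)) (\<lambda>r. ends_incr (Suc l) (word r))"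
  let ?P2 = "Node_of (\<lambda>u. u = Leaf)
    (\<lambda>r. r \<noteq> Leaf \<and> begins_decr k (word r) \<and> ends_incr (Suc l) (word r))"
  let ?P3 = "Node_of (\<lambda>u. u \<noteq> Leaf \<and> begins_decr (Suc k) (word u) \<and> ends_incr l (word u))
    (\<lambda>r. r = Leaf)"
  let ?P4 = "\<lambda>t. t = Node Leaf Leaf \<and> k = 0 \<and> l = 0"
  have Nil: "begins_decr k [] \<longleftrightarrow> k = 0" "ends_incr l [] \<longleftrightarrow> l = 0"
    by (simp_all add: begins_decr_def ends_incr_def)
  have "(\<lambda>t. t \<noteq> Leaf \<and> begins_decr (Suc k) (word t) \<and> ends_incr (Suc l) (word t))
      = (\<lambda>t. ((?P1 t \<or> ?P2 t) \<or> ?P3 t) \<or> ?P4 t)"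
  proof
    fix t
    show "(t \<noteq> Leaf \<and> begins_decr (Suc k) (word t) \<and> ends_incr (Suc l) (word t))
      = (((?P1 t \<or> ?P2 t) \<or> ?P3 t) \<or> ?P4 t)"
      by (cases t) (auto simp: begins_decr_Node ends_incr_Node Nil simp del: word.simps(2))
  qed
  then have "decr_incr_gf (Suc k) (Suc l) = tree_gf (\<lambda>t. ((?P1 t \<or> ?P2 t) \<or> ?P3 t) \<or> ?P4 t)"
    unfolding decr_incr_gf_eq_tree_gf by (rule arg_cong)
  also have "\<dots> = tree_gf (\<lambda>t. (?P1 t \<or> ?P2 t) \<or> ?P3 t) + tree_gf ?P4"
    by (rule tree_gf_disj) auto
  also have "tree_gf (\<lambda>t. (?P1 t \<or> ?P2 t) \<or> ?P3 t) = tree_gf (\<lambda>t. ?P1 t \<or> ?P2 t) + tree_gf ?P3"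
    by (rule tree_gf_disj) (auto simp: Node_of_def)
  also have "tree_gf (\<lambda>t. ?P1 t \<or> ?P2 t) = tree_gf ?P1 + tree_gf ?P2"
    by (rule tree_gf_disj) (auto simp: Node_of_def)
  also have "tree_gf ?P1 = fps_X ^ (k + l + 3) * C ^ (k + l + 4)"
  proof -
    have "tree_gf ?P1 = fps_X * (fps_X ^ Suc k * C ^ Suc (Suc k)) * (fps_X ^ Suc l * C ^ Suc (Suc l))"
      by (simp only: tree_gf_Node_of begins_decr_gf ends_incr_gf)
    also have "\<dots> = fps_X ^ (Suc (Suc k + Suc l)) * C ^ (Suc (Suc k) + Suc (Suc l))"
      by (simp only: power_add power_Suc mult_ac)
    finally show ?thesis
      by (simp add: eval_nat_numeral)
  qed
  also have "tree_gf ?P2 = fps_X * decr_incr_gf k (Suc l)"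
    by (simp add: tree_gf_Node_of tree_gf_singleton decr_incr_gf_eq_tree_gf)
  also have "tree_gf ?P3 = fps_X * decr_incr_gf (Suc k) l"
    by (simp add: tree_gf_Node_of tree_gf_singleton decr_incr_gf_eq_tree_gf)
  also have "tree_gf ?P4 = (if k = 0 \<and> l = 0 then fps_X else 0)"
    using tree_gf_singleton[of "Node Leaf Leaf"] by simp
  finally show ?thesis .
qed

text \<open>
  The recursion in the uniform shape that matches the coefficient of \<open>y\<^sup>k z\<^sup>l\<close> after
  multiplication with \<open>1 - x (y + z)\<close>. The three exceptional pairs all come from the
  permutation of length one: peeling off its root leaves the empty permutation, which is not
  counted.
\<close>

lemma decr_incr_gf_rec:
  "decr_incr_gf k l
    - fps_X * ((if k = 0 then 0 else decr_incr_gf (k - 1) l)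
        + (if l = 0 then 0 else decr_incr_gf k (l - 1)))
    = (if (k, l) \<in> {(1, 0), (0, 1), (1, 1)} then fps_X else 0)
        + (C - 1) * (fps_X * C) ^ (k + l)"
proof -
  have step: "(C - 1) * (fps_X * C) ^ i = fps_X ^ i * (C ^ Suc i - C ^ i)" for i
    by (simp add: algebra_simps)
  show ?thesis
  proof (cases k; cases l)
    fix k' l' assume kl: "k = Suc k'" "l = Suc l'"
    have "fps_X ^ (k' + l' + 3) * C ^ (k' + l' + 4) = (C - 1) * (fps_X * C) ^ (Suc k' + Suc l')"
      unfolding step using catalan_power_step[of "k' + l' + 2" "k' + l' + 2"]
      by (simp add: eval_nat_numeral right_diff_distrib)
    then show ?thesis
      unfolding kl decr_incr_gf_Suc_Suc by (simp add: distrib_left)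
  next
    fix k' assume "k = Suc k'" "l = 0"
    then show ?thesis
      unfolding step
      by (cases k') (simp_all add: decr_incr_gf_0_0 decr_incr_gf_Suc_0 algebra_simps power2_eq_square)
  next
    fix l' assume "k = 0" "l = Suc l'"
    then show ?thesis
      unfolding step
      by (cases l') (simp_all add: decr_incr_gf_0_0 decr_incr_gf_0_Suc algebra_simps power2_eq_square)
  qed (simp add: decr_incr_gf_0_0)
qed

lemma nth_xyz [simp]:
  "(of_fps_x c * F) $ l $ k = c * F $ l $ k"
  "(Y_var * F) $ l $ k = (if k = 0 then 0 else F $ l $ (k - 1))"
  "(Z_var * F) $ l $ k = (if l = 0 then 0 else F $ (l - 1) $ k)"
  "double_gf f $ l $ k = f k l"
  by (simp_all add: of_fps_x_def Y_var_def Z_var_def double_gf_def)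

lemma fps_xyz_eqI: "(\<And>l k. F $ l $ k = G $ l $ k) \<Longrightarrow> F = (G :: fps_xyz)"
  by (simp add: fps_eq_iff)

text \<open>
  With \<open>a = x C\<close> this is the reciprocal of the denominator \<open>(1 - x y C) (1 - x z C)\<close>; the two
  geometric series are removed one variable at a time.
\<close>

lemma double_gf_geometric:
  "double_gf (\<lambda>k l. a ^ (k + l)) * ((1 - Y_var * of_fps_x a) * (1 - Z_var * of_fps_x a)) = 1"
proof -
  define A where "A = double_gf (\<lambda>k l. a ^ (k + l))"
  define B where "B = double_gf (\<lambda>k l. if l = 0 then a ^ k else 0)"
  have "A - Z_var * (of_fps_x a * A) = B"
  proof (rule fps_xyz_eqI)
    fix l k show "(A - Z_var * (of_fps_x a * A)) $ l $ k = B $ l $ k"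
      unfolding A_def B_def fps_sub_nth nth_xyz by (cases l) simp_all
  qed
  moreover have "B - Y_var * (of_fps_x a * B) = 1"
  proof (rule fps_xyz_eqI)
    fix l k show "(B - Y_var * (of_fps_x a * B)) $ l $ k = 1 $ l $ k"
      unfolding B_def fps_sub_nth nth_xyz by (cases k; cases l) simp_all
  qed
  moreover have "A * ((1 - Y_var * of_fps_x a) * (1 - Z_var * of_fps_x a))
      = (A - Z_var * (of_fps_x a * A)) - Y_var * (of_fps_x a * (A - Z_var * (of_fps_x a * A)))"
    by (simp add: algebra_simps)
  ultimately show ?thesis
    by (simp add: A_def)
qed

lemma decr_incr_double_gf:
  "double_gf decr_incr_gf
        = 1 / (1 - X_var * (Y_var + Z_var))
          * (X_var * (Y_var + Z_var + Y_var * Z_var)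
             + (of_fps_x C - 1)
               / ((1 - X_var * Y_var * of_fps_x C) * (1 - X_var * Z_var * of_fps_x C)))"
proof -
  define a where "a = fps_X * C"
  define D where "D = 1 - X_var * (Y_var + Z_var)"
  define E where "E = (1 - X_var * Y_var * of_fps_x C) * (1 - X_var * Z_var * of_fps_x C)"
  define M where "M = X_var * (Y_var + Z_var + Y_var * Z_var)"
  define V where "V = of_fps_x (C - 1) * double_gf (\<lambda>k l. a ^ (k + l))"
  have of_a: "of_fps_x a = X_var * of_fps_x C"
    by (simp add: a_def of_fps_x_def X_var_def)
  have of_diff: "of_fps_x (C - 1) = of_fps_x C - 1"
    by (simp add: of_fps_x_def flip: fps_const_sub)
  have "E = (1 - Y_var * of_fps_x a) * (1 - Z_var * of_fps_x a)"
    by (simp add: E_def of_a mult_ac)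
  then have "of_fps_x C - 1 = V * E"
    using double_gf_geometric[of a] by (simp add: V_def of_diff mult.assoc)
  then have V: "(of_fps_x C - 1) / E = V"
    using denominator_units(2)[of C] unfolding E_def by (subst fps_divide_unit_iterated) auto
  have one: "1 = 1 / D * D"
    using fps_divide_unit_iterated[of D 1 "1 / D"] denominator_units(1) by (simp add: D_def)
  \<comment> \<open>Written with every product headed by a variable, so that its coefficients can be read off.\<close>
  have "double_gf decr_incr_gf - X_var * (Y_var * double_gf decr_incr_gf + Z_var * double_gf decr_incr_gf)
      = X_var * (Y_var * 1 + Z_var * 1 + Y_var * (Z_var * 1)) + V"
  proof (rule fps_xyz_eqI)
    fix l k
    show "(double_gf decr_incr_gf
          - X_var * (Y_var * double_gf decr_incr_gf + Z_var * double_gf decr_incr_gf)) $ l $ k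
      = (X_var * (Y_var * 1 + Z_var * 1 + Y_var * (Z_var * 1)) + V) $ l $ k"
      unfolding X_var_def V_def fps_add_nth fps_sub_nth nth_xyz a_def decr_incr_gf_rec
      by (cases k; cases l; cases "k - 1"; cases "l - 1") simp_all
  qed
  then have "D * double_gf decr_incr_gf = M + V"
    by (simp add: D_def M_def algebra_simps)
  then have "double_gf decr_incr_gf = 1 / D * (M + V)"
    by (metis one mult.assoc mult_1_left)
  then show ?thesis
    unfolding D_def M_def V[symmetric] E_def .
qed

theorem proposition21:
  shows "(\<forall>k l m :: nat. 1 \<le> k \<longrightarrow> 1 \<le> l \<longrightarrow> m = max k l \<longrightarrow>
      perm_gf avoids_13_2 (begins_incr k) (ends_incr l)
        = fps_X ^ (k + l - 1) * catalan_gf ^ (l + 1)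
          + (fps_X ^ m - fps_X ^ (k + l - 1)) / (1 - fps_X)
    \<and> perm_gf avoids_13_2 (begins_incr k) (ends_decr l)
        = fps_X ^ (k + l - 1) * catalan_gf ^ 2
    \<and> perm_gf avoids_13_2 (begins_decr k) (ends_decr l)
        = fps_X ^ (k + l - 1) * catalan_gf ^ (k + 1)
          + (fps_X ^ m - fps_X ^ (k + l - 1)) / (1 - fps_X))
    \<and> double_gf (\<lambda>k l. perm_gf avoids_13_2 (begins_decr k) (ends_incr l))
        = 1 / (1 - X_var * (Y_var + Z_var))
          * (X_var * (Y_var + Z_var + Y_var * Z_var)
             + (of_fps_x catalan_gf - 1)
               / ((1 - X_var * Y_var * of_fps_x catalan_gf)
                  * (1 - X_var * Z_var * of_fps_x catalan_gf)))"
proof (intro conjI allI impI)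
  fix k l m :: nat
  assume "1 \<le> k" "1 \<le> l" and m: "m = max k l"
  then obtain k' l' where k: "k = Suc k'" and l: "l = Suc l'"
    by (metis One_nat_def Suc_le_D)
  have geom: "(fps_X ^ m - fps_X ^ (k + l - 1)) / (1 - fps_X)
      = (\<Sum>i = m..<k + l - 1. fps_X ^ i :: real fps)"
    by (rule geometric_block) (simp add: m k l)
  show "perm_gf avoids_13_2 (begins_incr k) (ends_incr l)
      = fps_X ^ (k + l - 1) * C ^ (l + 1) + (fps_X ^ m - fps_X ^ (k + l - 1)) / (1 - fps_X)"
    unfolding geom unfolding m k l perm_gf_begins_incr begins_incr_ends_incr_gf by simp
  show "perm_gf avoids_13_2 (begins_incr k) (ends_decr l) = fps_X ^ (k + l - 1) * C ^ 2"
    unfolding k l perm_gf_begins_incr begins_incr_ends_decr_gf by simp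
  show "perm_gf avoids_13_2 (begins_decr k) (ends_decr l)
      = fps_X ^ (k + l - 1) * C ^ (k + 1) + (fps_X ^ m - fps_X ^ (k + l - 1)) / (1 - fps_X)"
    unfolding geom
    unfolding m k l perm_gf_ends_decr begins_decr_ends_decr_gf begins_incr_ends_incr_gf
    by (simp add: add.commute max.commute)
next
  show "double_gf (\<lambda>k l. perm_gf avoids_13_2 (begins_decr k) (ends_incr l))
        = 1 / (1 - X_var * (Y_var + Z_var))
          * (X_var * (Y_var + Z_var + Y_var * Z_var)
             + (of_fps_x C - 1)
               / ((1 - X_var * Y_var * of_fps_x C) * (1 - X_var * Z_var * of_fps_x C)))"
    using decr_incr_double_gf unfolding decr_incr_gf_def .
qed

end
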